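(* For every $k\ge1$ and every metric space $M$, the online algorithm HANDICAP for the $k$-server problem is $k$-competitive against any adversary which can have at most one open server: there is a constant $K$ (depending only on the initial configurations) such that for every request sequence served by such an adversary, $\mathrm{cost}_{\mathrm{HANDICAP}}\le k\cdot \mathrm{cost}_{adv}+K$.
   Context: The $k$-server problem: $k$ mobile servers sit at points of a metric space $(M,d)$ (pseudo-metrics allowed); at each step a request point $r\in M$ is given and some server must move to $r$; cost is total distance traveled. An online algorithm decides without knowledge of future requests; the adversary generates the requests and also serves them with its own $k$ servers. HANDICAP maintains real numbers $E_1,\dots,E_k$ (initially $0$), one per algorithm server $s_1,\dots,s_k$; on request $r$ it chooses an index $i$ minimizing $E_i+d(s_i,r)$ (ties arbitrary), then for every $j$ replaces $E_j$ by $E_j+\tfrac12\bigl(d(r,s_i)+d(r,s_j)-d(s_i,s_j)\bigr)$, and moves $s_i$ to $r$ (no other server moves). With the adversary's servers $a_1,\dots,a_k$ indexed so that $s_i\leftrightarrow a_i$ is a minimum-cost matching, an adversary server $a_i$ is open if $a_i\ne s_i$; "at most one open server" means that at all times at most one adversary server is open (e.g. the lazy adversary, which only requests points occupied by its own servers but not by the algorithm's). *)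

theory Defs
  imports "HOL-Analysis.Analysis"
begin

locale pseudometric_space =
  fixes M :: "'a set" and d :: "'a \<Rightarrow> 'a \<Rightarrow> real"
  assumes nonneg: "\<lbrakk>x \<in> M; y \<in> M\<rbrakk> \<Longrightarrow> 0 \<le> d x y"
    and self: "x \<in> M \<Longrightarrow> d x x = 0"
    and commute: "\<lbrakk>x \<in> M; y \<in> M\<rbrakk> \<Longrightarrow> d x y = d y x"
    and triangle: "\<lbrakk>x \<in> M; y \<in> M; z \<in> M\<rbrakk> \<Longrightarrow> d x z \<le> d x y + d y z"

lemma Metric_space_imp_pseudometric_space:
  assumes "Metric_space M d"
  shows "pseudometric_space M d"
proof -
  interpret Metric_space M d by fact
  show ?thesis by unfold_locales (auto intro: triangle commute)
qed

text \<open>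
  A configuration of \<open>k\<close> servers gives the position of server \<open>i\<close> for each \<open>i < k\<close>;
  its values at indices \<open>i \<ge> k\<close> are irrelevant. In a history \<open>c :: nat \<Rightarrow> 'a config\<close>,
  \<open>c t\<close> is the configuration after the first \<open>t\<close> requests have been served; the request
  served between times \<open>t\<close> and \<open>Suc t\<close> is \<open>r t\<close>.
\<close>

type_synonym 'a config = "nat \<Rightarrow> 'a"

definition config_in :: "nat \<Rightarrow> 'a set \<Rightarrow> 'a config \<Rightarrow> bool" where
  "config_in k M c \<longleftrightarrow> (\<forall>i<k. c i \<in> M)"

definition same_config :: "nat \<Rightarrow> 'a config \<Rightarrow> 'a config \<Rightarrow> bool" where
  "same_config k c c' \<longleftrightarrow> (\<forall>i<k. c i = c' i)"

definition total_cost ::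
    "nat \<Rightarrow> ('a \<Rightarrow> 'a \<Rightarrow> real) \<Rightarrow> (nat \<Rightarrow> 'a config) \<Rightarrow> nat \<Rightarrow> real" where
  "total_cost k d c n = (\<Sum>t<n. \<Sum>i<k. d (c t i) (c (Suc t) i))"

text \<open>
  The index \<open>i\<close> of the moving server is existentially quantified, so that ties
  may be broken arbitrarily, differently at every step.
\<close>

definition handicap_step ::
    "nat \<Rightarrow> ('a \<Rightarrow> 'a \<Rightarrow> real) \<Rightarrow> 'a \<Rightarrow> 'a config \<Rightarrow> (nat \<Rightarrow> real) \<Rightarrow>
      'a config \<Rightarrow> (nat \<Rightarrow> real) \<Rightarrow> bool" where
  "handicap_step k d r s E s' E' \<longleftrightarrow>
    (\<exists>i<k. (\<forall>j<k. E i + d (s i) r \<le> E j + d (s j) r) \<and>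
           (\<forall>j<k. E' j = E j + (d r (s i) + d r (s j) - d (s i) (s j)) / 2) \<and>
           (\<forall>j<k. s' j = (if j = i then r else s j)))"

definition handicap_run ::
    "nat \<Rightarrow> ('a \<Rightarrow> 'a \<Rightarrow> real) \<Rightarrow> (nat \<Rightarrow> 'a) \<Rightarrow> nat \<Rightarrow>
      (nat \<Rightarrow> 'a config) \<Rightarrow> (nat \<Rightarrow> nat \<Rightarrow> real) \<Rightarrow> bool" where
  "handicap_run k d r n s E \<longleftrightarrow>
    (\<forall>j<k. E 0 j = 0) \<and>
    (\<forall>t<n. handicap_step k d (r t) (s t) (E t) (s (Suc t)) (E (Suc t)))"

text \<open>The adversary may move any number of its servers at each step.\<close>

definition serves :: "nat \<Rightarrow> 'a set \<Rightarrow> (nat \<Rightarrow> 'a) \<Rightarrow> nat \<Rightarrow> (nat \<Rightarrow> 'a config) \<Rightarrow> bool" where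
  "serves k M r n a \<longleftrightarrow>
    (\<forall>t\<le>n. config_in k M (a t)) \<and> (\<forall>t<n. \<exists>i<k. a (Suc t) i = r t)"

text \<open>A matching \<open>p\<close> pairs the server at \<open>s i\<close> with the adversary server at \<open>a (p i)\<close>.\<close>

definition matching_cost ::
    "nat \<Rightarrow> ('a \<Rightarrow> 'a \<Rightarrow> real) \<Rightarrow> 'a config \<Rightarrow> 'a config \<Rightarrow> (nat \<Rightarrow> nat) \<Rightarrow> real" where
  "matching_cost k d s a p = (\<Sum>i<k. d (s i) (a (p i)))"

definition min_matching ::
    "nat \<Rightarrow> ('a \<Rightarrow> 'a \<Rightarrow> real) \<Rightarrow> 'a config \<Rightarrow> 'a config \<Rightarrow> (nat \<Rightarrow> nat) \<Rightarrow> bool" where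
  "min_matching k d s a p \<longleftrightarrow>
    p permutes {..<k} \<and>
    (\<forall>q. q permutes {..<k} \<longrightarrow> matching_cost k d s a p \<le> matching_cost k d s a q)"

text \<open>
  Minimum-cost matchings need not be unique, and the number of open servers can depend on
  the choice: on the real line with servers at 0, 1 and adversary servers at 1, 2, both
  matchings have cost 2, one with one open server and the other with two. It is only
  required that some minimum-cost matching leaves at most one adversary server open.
\<close>

definition at_most_one_open ::
    "nat \<Rightarrow> ('a \<Rightarrow> 'a \<Rightarrow> real) \<Rightarrow> 'a config \<Rightarrow> 'a config \<Rightarrow> bool" where
  "at_most_one_open k d s a \<longleftrightarrow>
    (\<exists>p. min_matching k d s a p \<and> card {i. i < k \<and> a (p i) \<noteq> s i} \<le> 1)"

text \<open>
  At each step the adversary moves first, so besides the configurations between steps there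
  is the situation where the adversary has served the request and the algorithm has not.
\<close>

definition always_at_most_one_open ::
    "nat \<Rightarrow> ('a \<Rightarrow> 'a \<Rightarrow> real) \<Rightarrow> nat \<Rightarrow> (nat \<Rightarrow> 'a config) \<Rightarrow> (nat \<Rightarrow> 'a config) \<Rightarrow> bool" where
  "always_at_most_one_open k d n s a \<longleftrightarrow>
    (\<forall>t\<le>n. at_most_one_open k d (s t) (a t)) \<and>
    (\<forall>t<n. at_most_one_open k d (s t) (a (Suc t)))"

end

theory Submission
  imports Defs
begin

text \<open>
  Write \<open>W\<^sub>c(y)\<close> for the sum of the distances from the servers of \<open>c\<close> to \<open>y\<close>, and
  \<open>T\<close> for the sum of \<open>W\<^sub>s(s\<^sub>j)\<close> over all \<open>j\<close>. The handicaps are an exact account of the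
  cost: every step increases \<open>2 (\<Sum>\<^sub>j E\<^sub>j) - T / 2\<close> by \<open>k + 1\<close> times the distance travelled.
  On the other hand each single handicap satisfies the invariant
  \<open>2 E\<^sub>j + W\<^sub>a(s\<^sub>j) \<le> C + cost + cost\<^sub>a\<^sub>d\<^sub>v + W\<^sub>s(s\<^sub>j)\<close>: moves of the adversary preserve it
  because \<open>W\<close> is 1-Lipschitz in the configuration, a move of the algorithm does not change
  its slack for the servers that stay, and for the moving server it follows from the
  minimality of \<open>E\<^sub>i + d(s\<^sub>i, r)\<close>, compared with the server matched to the adversary
  server on \<open>r\<close>. Summing the invariant over \<open>j\<close> and cancelling \<open>k\<close> times the cost against
  the account leaves \<open>cost \<le> k cost\<^sub>a\<^sub>d\<^sub>v + K + T / 2 - \<Sum>\<^sub>j W\<^sub>a(s\<^sub>j)\<close>, and \<open>T / 2\<close> is at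
  most \<open>\<Sum>\<^sub>j W\<^sub>a(s\<^sub>j)\<close> when only one adversary server is open.
\<close>

section \<open>Distance sums of configurations\<close>

definition dist_sum :: "nat \<Rightarrow> ('a \<Rightarrow> 'a \<Rightarrow> real) \<Rightarrow> 'a config \<Rightarrow> 'a \<Rightarrow> real" where
  "dist_sum k d c y = (\<Sum>l<k. d (c l) y)"

text \<open>For \<open>c = c' = s\<close> this is the quantity \<open>T\<close>, in which each pair
  of servers counts twice.\<close>

definition cross_sum :: "nat \<Rightarrow> ('a \<Rightarrow> 'a \<Rightarrow> real) \<Rightarrow> 'a config \<Rightarrow> 'a config \<Rightarrow> real" where
  "cross_sum k d c c' = (\<Sum>j<k. dist_sum k d c (c' j))"

lemma sum_config_update:
  fixes f :: "'a \<Rightarrow> real" and k :: nat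
  assumes "i < k" and "\<And>j. j < k \<Longrightarrow> s' j = (if j = i then r else s j)"
  shows "(\<Sum>j<k. f (s' j)) = (\<Sum>j<k. f (s j)) - f (s i) + f r"
proof -
  have "(\<Sum>j\<in>{..<k} - {i}. f (s' j)) = (\<Sum>j\<in>{..<k} - {i}. f (s j))"
    by (rule sum.cong) (auto simp: assms(2))
  then show ?thesis
    using assms(1) assms(2)[of i]
      sum.remove[OF finite_lessThan, of i _ "\<lambda>j. f (s' j)"]
      sum.remove[OF finite_lessThan, of i _ "\<lambda>j. f (s j)"]
    by simp
qed

lemma dist_sum_update:
  assumes "i < k" and "\<And>j. j < k \<Longrightarrow> s' j = (if j = i then r else s j)"
  shows "dist_sum k d s' y = dist_sum k d s y - d (s i) y + d r y"
  unfolding dist_sum_def using sum_config_update[OF assms, where f = "\<lambda>x. d x y"] by simp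

lemma cross_sum_cong:
  "same_config k c c1 \<Longrightarrow> same_config k c' c1' \<Longrightarrow> cross_sum k d c c' = cross_sum k d c1 c1'"
  by (simp add: cross_sum_def dist_sum_def same_config_def)

context pseudometric_space
begin

lemma dist_sum_nonneg: "config_in k M c \<Longrightarrow> y \<in> M \<Longrightarrow> 0 \<le> dist_sum k d c y"
  by (auto simp: dist_sum_def config_in_def intro!: sum_nonneg nonneg)

text \<open>Only row and column \<open>i\<close> of the distance matrix change, hence the factor 2.
  The term \<open>d (s i) r\<close> is subtracted because \<open>dist_sum k d s r\<close> still
  counts the vacated position \<open>s i\<close>.\<close>

lemma cross_sum_update:
  assumes i: "i < k" and s': "\<And>j. j < k \<Longrightarrow> s' j = (if j = i then r else s j)"
    and s: "config_in k M s" and r: "r \<in> M"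
  shows "cross_sum k d s' s' =
    cross_sum k d s s + 2 * (dist_sum k d s r - dist_sum k d s (s i) - d (s i) r)"
proof -
  have mem: "\<And>j. j < k \<Longrightarrow> s j \<in> M" using s by (simp add: config_in_def)
  have sym: "(\<Sum>j<k. d x (s j)) = dist_sum k d s x" if "x \<in> M" for x
    unfolding dist_sum_def by (rule sum.cong) (auto simp: commute mem that)
  have "cross_sum k d s' s' =
      (\<Sum>j<k. dist_sum k d s' (s j)) - dist_sum k d s' (s i) + dist_sum k d s' r"
    unfolding cross_sum_def by (rule sum_config_update[OF i s'])
  also have "(\<Sum>j<k. dist_sum k d s' (s j)) =
      cross_sum k d s s - dist_sum k d s (s i) + dist_sum k d s r"
    by (simp add: dist_sum_update[OF i s'] cross_sum_def sum.distrib sum_subtractf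
        sym mem i r)
  finally show ?thesis
    using commute[OF r mem[OF i]] self[OF r] self[OF mem[OF i]]
    by (simp add: dist_sum_update[OF i s'])
qed

lemma dist_sum_Lipschitz:
  assumes "config_in k M c" "config_in k M c'" "y \<in> M"
  shows "dist_sum k d c' y \<le> dist_sum k d c y + (\<Sum>l<k. d (c l) (c' l))"
  unfolding dist_sum_def sum.distrib[symmetric]
proof (rule sum_mono)
  fix l assume "l \<in> {..<k}"
  then have "c l \<in> M" "c' l \<in> M" using assms by (auto simp: config_in_def)
  then show "d (c' l) y \<le> d (c l) y + d (c l) (c' l)"
    using triangle[of "c' l" "c l" y] commute[of "c l" "c' l"] assms(3) by simp
qed

lemma step_cost:
  assumes i: "i < k" and s': "\<And>j. j < k \<Longrightarrow> s' j = (if j = i then r else s j)"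
    and s: "config_in k M s"
  shows "(\<Sum>j<k. d (s j) (s' j)) = d (s i) r"
proof -
  have "(\<Sum>j<k. d (s j) (s' j)) = (\<Sum>j<k. if j = i then d (s i) r else 0)"
    using s by (intro sum.cong) (auto simp: s' self config_in_def)
  then show ?thesis using i by simp
qed

section \<open>Configurations with at most one open server\<close>

text \<open>This will be applied to the adversary server \<open>l\<close> on the request: either its
  partner is already there, or \<open>l\<close> is the open server and all other pairs
  coincide.\<close>

lemma one_open_cases:
  assumes "at_most_one_open k d s a" and "l < k"
  obtains p j where "p permutes {..<k}" "j < k" "p j = l" "a l = s j"
  | p j where "p permutes {..<k}" "j < k" "p j = l" "\<And>i. i < k \<Longrightarrow> i \<noteq> j \<Longrightarrow> a (p i) = s i"
proof -
  from assms(1) obtain p where p: "p permutes {..<k}"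
    and c: "card {i. i < k \<and> a (p i) \<noteq> s i} \<le> 1"
    unfolding at_most_one_open_def min_matching_def by blast
  obtain j where j: "j < k" "p j = l"
    using assms(2) permutes_image[OF p] by (metis imageE lessThan_iff)
  show thesis
  proof (cases "a l = s j")
    case True
    then show ?thesis using that(1) p j by blast
  next
    case False
    have "a (p i) = s i" if "i < k" "i \<noteq> j" for i
    proof (rule ccontr)
      assume "a (p i) \<noteq> s i"
      then have "{i, j} \<subseteq> {i. i < k \<and> a (p i) \<noteq> s i}" using that j False by auto
      then have "card {i, j} \<le> card {i. i < k \<and> a (p i) \<noteq> s i}"
        by (intro card_mono) auto
      then show False using c that by simp
    qed
    then show ?thesis using that(2) p j by blast
  qed
qed

lemma dist_sum_one_open:
  assumes p: "p permutes {..<k}" and "j < k"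
    and closed: "\<And>i. i < k \<Longrightarrow> i \<noteq> j \<Longrightarrow> a (p i) = s i"
  shows "dist_sum k d a y = dist_sum k d s y - d (s j) y + d (a (p j)) y"
proof -
  have "dist_sum k d a y = dist_sum k d (a \<circ> p) y"
    unfolding dist_sum_def using sum.permute[OF p, of "\<lambda>l. d (a l) y"] by simp
  also have "\<dots> = dist_sum k d s y - d (s j) y + d (a (p j)) y"
    by (rule dist_sum_update) (use \<open>j < k\<close> in \<open>auto simp: closed\<close>)
  finally show ?thesis .
qed

text \<open>Up to relabelling, \<open>a\<close> is \<open>s\<close> with only \<open>s m\<close>
  relocated, so passing from \<open>s\<close> to \<open>a\<close> loses at most the sum
  \<open>D\<close> of row \<open>m\<close> of the distance matrix of \<open>s\<close>. Row and
  column \<open>m\<close> both sum to \<open>D\<close> and share only a zero diagonal entry, so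
  \<open>D\<close> is at most half of the whole.\<close>

lemma cross_sum_one_open:
  assumes k: "0 < k" and one: "at_most_one_open k d s a"
    and s: "config_in k M s" and a: "config_in k M a"
  shows "cross_sum k d s s \<le> 2 * cross_sum k d a s"
proof -
  have mem: "\<And>j. j < k \<Longrightarrow> s j \<in> M" "\<And>j. j < k \<Longrightarrow> a j \<in> M"
    using s a by (auto simp: config_in_def)
  obtain p m where p: "p permutes {..<k}" and m: "m < k"
    and closed: "\<And>i. i < k \<Longrightarrow> i \<noteq> m \<Longrightarrow> a (p i) = s i"
  proof -
    from one obtain q where q: "q permutes {..<k}"
      and c: "card {i. i < k \<and> a (q i) \<noteq> s i} \<le> 1"
      unfolding at_most_one_open_def min_matching_def by blast
    show thesis
    proof (cases "\<exists>i<k. a (q i) \<noteq> s i")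
      \<comment> \<open>With no open server any index below \<open>k\<close> can serve as
        \<open>m\<close>; positivity of \<open>k\<close> provides one.\<close>
      case False
      then show ?thesis using that q k by blast
    next
      case True
      then obtain i where i: "i < k" "a (q i) \<noteq> s i" by blast
      have "j = i" if "j < k" "a (q j) \<noteq> s j" for j
        using c i that by (auto simp: card_le_Suc0_iff_eq)
      then show ?thesis using that q i by blast
    qed
  qed
  have pm: "p m < k" using permutes_in_image[OF p, of m] m by simp
  define D where "D = (\<Sum>j<k. d (s m) (s j))"
  have D: "dist_sum k d s (s m) = D"
    unfolding D_def dist_sum_def by (rule sum.cong) (auto simp: commute mem m)
  have "cross_sum k d s s - D \<le> cross_sum k d a s"
    unfolding D_def cross_sum_def sum_subtractf[symmetric]
    by (rule sum_mono) (use dist_sum_one_open[of p k m a s, OF p m closed] nonneg mem pm in auto)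
  moreover have "2 * D \<le> cross_sum k d s s"
  proof -
    have "D = d (s m) (s m) + (\<Sum>j\<in>{..<k} - {m}. d (s m) (s j))"
      unfolding D_def using m by (simp add: sum.remove)
    also have "\<dots> \<le> (\<Sum>j\<in>{..<k} - {m}. dist_sum k d s (s j))"
      unfolding self[OF mem(1)[OF m]] add_0 dist_sum_def
      by (intro sum_mono member_le_sum[where f = "\<lambda>l. d (s l) (s _)"])
        (use m in \<open>auto intro: nonneg mem\<close>)
    finally show ?thesis
      unfolding cross_sum_def using m D by (simp add: sum.remove[of "{..<k}" m])
  qed
  ultimately show ?thesis by linarith
qed

section \<open>One step of the algorithm\<close>

text \<open>Here \<open>B\<close> stands for the constant plus both costs so far, and the adversary has
  already moved.\<close>

lemma handicap_bound_step:
  assumes bound: "\<And>j. j < k \<Longrightarrow> 2 * E j + dist_sum k d a (s j) \<le> B + dist_sum k d s (s j)"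
    and i: "i < k" and min: "\<And>j. j < k \<Longrightarrow> E i + d (s i) r \<le> E j + d (s j) r"
    and E': "\<And>j. j < k \<Longrightarrow> E' j = E j + (d r (s i) + d r (s j) - d (s i) (s j)) / 2"
    and s': "\<And>j. j < k \<Longrightarrow> s' j = (if j = i then r else s j)"
    and one: "at_most_one_open k d s a" and l: "l < k" "a l = r"
    and s: "config_in k M s" and r: "r \<in> M" and j: "j < k"
  shows "2 * E' j + dist_sum k d a (s' j) \<le> B + d (s i) r + dist_sum k d s' (s' j)"
proof -
  have mem: "\<And>j. j < k \<Longrightarrow> s j \<in> M" using s by (simp add: config_in_def)
  show ?thesis
  proof (cases "j = i")
    case False
    then show ?thesis
      using bound[OF j] commute[OF r mem[OF i]] E'[OF j] s'[OF j] dist_sum_update[OF i s', of d "s j"]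
      by (simp add: field_simps)
  next
    case True
    \<comment> \<open>This is the goal for \<open>j = i\<close> rewritten: the new handicap is
      \<open>E i + d (s i) r\<close>, and \<open>dist_sum k d s' r + d (s i) r\<close> equals
      \<open>dist_sum k d s r\<close>.\<close>
    have "2 * (E i + d (s i) r) + dist_sum k d a r \<le> B + dist_sum k d s r"
      using one l(1)
    proof (cases rule: one_open_cases)
      case (1 p m)
      then show ?thesis
        using bound[of m] min[of m] self[OF r] l by simp
    next
      \<comment> \<open>Here \<open>bound\<close> at \<open>m\<close> reduces to
        \<open>2 * E m + d (s m) r \<le> B\<close>. Minimality costs a further
        \<open>d (s m) r\<close>, which is exactly what \<open>dist_sum k d a r\<close> falls short
        of \<open>dist_sum k d s r\<close>.\<close>
      case (2 p m)
      have "dist_sum k d a y = dist_sum k d s y - d (s m) y + d r y" for y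
        using dist_sum_one_open[of p k m a s] 2 l by simp
      then show ?thesis
        using bound[of m] min[of m] self[OF r] self[OF mem[of m]] commute[OF r mem[of m]] 2
        by simp
    qed
    then show ?thesis
      using True self[OF r] self[OF mem[OF i]] commute[OF r mem[OF i]] E'[OF i] s'[OF i]
        dist_sum_update[OF i s', of d]
      by (simp add: field_simps)
  qed
qed

text \<open>Twice the handicap sum gains \<open>k * d (s i) r\<close> plus the change of
  \<open>dist_sum k d s\<close> from \<open>s i\<close> to \<open>r\<close>. Half of
  \<open>cross_sum\<close> gains that same change minus \<open>d (s i) r\<close>, so the difference
  leaves \<open>k + 1\<close> copies.\<close>

lemma handicap_account_step:
  assumes i: "i < k"
    and E': "\<And>j. j < k \<Longrightarrow> E' j = E j + (d r (s i) + d r (s j) - d (s i) (s j)) / 2"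
    and s': "\<And>j. j < k \<Longrightarrow> s' j = (if j = i then r else s j)"
    and s: "config_in k M s" and r: "r \<in> M"
  shows "2 * (\<Sum>j<k. E' j) - cross_sum k d s' s' / 2 =
    2 * (\<Sum>j<k. E j) - cross_sum k d s s / 2 + (real k + 1) * d (s i) r"
proof -
  have mem: "\<And>j. j < k \<Longrightarrow> s j \<in> M" using s by (simp add: config_in_def)
  have sym: "(\<Sum>j<k. d x (s j)) = dist_sum k d s x" if "x \<in> M" for x
    unfolding dist_sum_def by (rule sum.cong) (auto simp: commute mem that)
  have "(\<Sum>j<k. E' j) =
      (\<Sum>j<k. E j) + (real k * d r (s i) + dist_sum k d s r - dist_sum k d s (s i)) / 2"
    by (simp add: E' sum.distrib sum_subtractf sum_divide_distrib[symmetric] sym r mem i)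
  then show ?thesis
    using commute[OF r mem[OF i]] cross_sum_update[OF i s' s r]
    by (simp add: field_simps)
qed

section \<open>Induction over the requests and the final estimate\<close>

lemma handicap_invariants:
  assumes r: "\<forall>t<n. r t \<in> M"
    and s0: "config_in k M (s 0)"
    and run: "handicap_run k d r n s E"
    and serves: "serves k M r n a"
    and one: "always_at_most_one_open k d n s a"
    and "t \<le> n"
  shows "config_in k M (s t) \<and>
    2 * (\<Sum>j<k. E t j) - cross_sum k d (s t) (s t) / 2 =
      (real k + 1) * total_cost k d s t - cross_sum k d (s 0) (s 0) / 2 \<and>
    (\<forall>j<k. 2 * E t j + dist_sum k d (a t) (s t j) \<le>
      cross_sum k d (a 0) (s 0) + total_cost k d s t + total_cost k d a t +
      dist_sum k d (s t) (s t j))"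
  using \<open>t \<le> n\<close>
proof (induction t)
  case 0
  have a0: "config_in k M (a 0)" using serves by (simp add: serves_def)
  have E0: "\<And>j. j < k \<Longrightarrow> E 0 j = 0" using run by (simp add: handicap_run_def)
  have mem: "\<And>j. j < k \<Longrightarrow> s 0 j \<in> M" using s0 by (simp add: config_in_def)
  \<comment> \<open>The constant in the invariant is the sum over all servers, so that it dominates
    every single initial term.\<close>
  have "dist_sum k d (a 0) (s 0 j) \<le> cross_sum k d (a 0) (s 0)" if "j < k" for j
    unfolding cross_sum_def
    by (rule member_le_sum[where f = "\<lambda>j. dist_sum k d (a 0) (s 0 j)"])
      (use that in \<open>auto intro: dist_sum_nonneg a0 mem\<close>)
  then show ?case
    using dist_sum_nonneg[OF s0 mem] s0 by (simp add: total_cost_def E0 add_increasing2)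
next
  case (Suc t)
  then have t: "t < n" by simp
  then have rt: "r t \<in> M" using r by simp
  from Suc.IH t have st: "config_in k M (s t)"
    and account: "2 * (\<Sum>j<k. E t j) - cross_sum k d (s t) (s t) / 2 =
      (real k + 1) * total_cost k d s t - cross_sum k d (s 0) (s 0) / 2"
    and bound: "\<And>j. j < k \<Longrightarrow> 2 * E t j + dist_sum k d (a t) (s t j) \<le>
      cross_sum k d (a 0) (s 0) + total_cost k d s t + total_cost k d a t +
      dist_sum k d (s t) (s t j)"
    by simp_all
  have at: "config_in k M (a t)" "config_in k M (a (Suc t))"
    using serves t by (auto simp: serves_def)
  obtain l where l: "l < k" "a (Suc t) l = r t" using serves t by (auto simp: serves_def)
  have "handicap_step k d (r t) (s t) (E t) (s (Suc t)) (E (Suc t))"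
    using run t by (simp add: handicap_run_def)
  then obtain i where i: "i < k"
    and min: "\<And>j. j < k \<Longrightarrow> E t i + d (s t i) (r t) \<le> E t j + d (s t j) (r t)"
    and E': "\<And>j. j < k \<Longrightarrow> E (Suc t) j =
      E t j + (d (r t) (s t i) + d (r t) (s t j) - d (s t i) (s t j)) / 2"
    and s': "\<And>j. j < k \<Longrightarrow> s (Suc t) j = (if j = i then r t else s t j)"
    unfolding handicap_step_def by blast
  have cost: "total_cost k d s (Suc t) = total_cost k d s t + d (s t i) (r t)"
    using step_cost[OF i s' st] by (simp add: total_cost_def)
  have open1: "at_most_one_open k d (s t) (a (Suc t))"
    using one t by (simp add: always_at_most_one_open_def)
  \<comment> \<open>The adversary's cost already includes the current step and the algorithm's does
    not: this is the intermediate situation to which \<open>open1\<close> refers.\<close>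
  let ?B = "cross_sum k d (a 0) (s 0) + total_cost k d s t + total_cost k d a (Suc t)"
  have "2 * E t j + dist_sum k d (a (Suc t)) (s t j) \<le> ?B + dist_sum k d (s t) (s t j)"
    if "j < k" for j
    using bound[OF that] dist_sum_Lipschitz[OF at, of "s t j"] st that
    by (simp add: total_cost_def config_in_def)
  note bound' = handicap_bound_step[OF this i min E' s' open1 l st rt]
  have "config_in k M (s (Suc t))" using st rt by (simp add: config_in_def s')
  moreover have "2 * (\<Sum>j<k. E (Suc t) j) - cross_sum k d (s (Suc t)) (s (Suc t)) / 2 =
      (real k + 1) * total_cost k d s (Suc t) - cross_sum k d (s 0) (s 0) / 2"
    using handicap_account_step[OF i E' s' st rt] account by (simp add: cost algebra_simps)
  moreover have "2 * E (Suc t) j + dist_sum k d (a (Suc t)) (s (Suc t) j) \<le>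
      cross_sum k d (a 0) (s 0) + total_cost k d s (Suc t) + total_cost k d a (Suc t) +
      dist_sum k d (s (Suc t)) (s (Suc t) j)" if "j < k" for j
    using bound'[of j] that by (simp add: cost)
  ultimately show ?case by blast
qed

lemma handicap_cost_bound:
  assumes k: "0 < k"
    and "\<forall>t<n. r t \<in> M"
    and "config_in k M (s 0)"
    and "handicap_run k d r n s E"
    and serves: "serves k M r n a"
    and one: "always_at_most_one_open k d n s a"
  shows "total_cost k d s n \<le> real k * total_cost k d a n +
    (real k * cross_sum k d (a 0) (s 0) + cross_sum k d (s 0) (s 0) / 2)"
proof -
  from handicap_invariants[OF assms(2-6) order.refl]
  have inv: "config_in k M (s n)"
      "2 * (\<Sum>j<k. E n j) - cross_sum k d (s n) (s n) / 2 =
      (real k + 1) * total_cost k d s n - cross_sum k d (s 0) (s 0) / 2"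
      "\<And>j. j < k \<Longrightarrow> 2 * E n j + dist_sum k d (a n) (s n j) \<le>
      cross_sum k d (a 0) (s 0) + total_cost k d s n + total_cost k d a n +
      dist_sum k d (s n) (s n j)"
    by blast+
  have "(\<Sum>j<k. 2 * E n j + dist_sum k d (a n) (s n j)) \<le>
      (\<Sum>j<k. cross_sum k d (a 0) (s 0) + total_cost k d s n + total_cost k d a n +
        dist_sum k d (s n) (s n j))"
    by (rule sum_mono) (simp add: inv(3))
  then have "2 * (\<Sum>j<k. E n j) + cross_sum k d (a n) (s n) \<le>
      real k * (cross_sum k d (a 0) (s 0) + total_cost k d s n + total_cost k d a n) +
      cross_sum k d (s n) (s n)"
    by (simp add: sum.distrib sum_distrib_left cross_sum_def[of k d "a n"]
        cross_sum_def[of k d "s n"] algebra_simps)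
  \<comment> \<open>After the account eliminates the handicaps, half the left side minus
    \<open>cross_sum k d (a n) (s n)\<close> is the only excess left.\<close>
  moreover have "cross_sum k d (s n) (s n) \<le> 2 * cross_sum k d (a n) (s n)"
    using serves one
    by (intro cross_sum_one_open k inv(1)) (auto simp: serves_def always_at_most_one_open_def)
  ultimately show ?thesis using inv(2) by (simp add: algebra_simps)
qed

end

theorem theorem3:
  fixes M :: "'a set" and d :: "'a \<Rightarrow> 'a \<Rightarrow> real" and k :: nat
    and s0 a0 :: "'a config"
  assumes "pseudometric_space M d" and "k \<ge> 1"
    and "config_in k M s0" and "config_in k M a0"
  shows "\<exists>K::real. \<forall>(n::nat) (r :: nat \<Rightarrow> 'a) (s :: nat \<Rightarrow> 'a config)
            (E :: nat \<Rightarrow> nat \<Rightarrow> real) (a :: nat \<Rightarrow> 'a config).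
          (\<forall>t<n. r t \<in> M) \<longrightarrow>
          same_config k (s 0) s0 \<longrightarrow> same_config k (a 0) a0 \<longrightarrow>
          handicap_run k d r n s E \<longrightarrow>
          serves k M r n a \<longrightarrow>
          always_at_most_one_open k d n s a \<longrightarrow>
          total_cost k d s n \<le> real k * total_cost k d a n + K"
proof (intro exI allI impI)
  fix n :: nat and r :: "nat \<Rightarrow> 'a" and s a :: "nat \<Rightarrow> 'a config"
    and E :: "nat \<Rightarrow> nat \<Rightarrow> real"
  assume asm: "\<forall>t<n. r t \<in> M" "same_config k (s 0) s0" "same_config k (a 0) a0"
    "handicap_run k d r n s E" "serves k M r n a" "always_at_most_one_open k d n s a"
  have s0: "config_in k M (s 0)"
    using assms(3) asm(2) by (simp add: config_in_def same_config_def)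
  have "0 < k" using assms(2) by simp
  \<comment> \<open>The constant has to be fixed before the run; \<open>s0\<close> and
    \<open>a0\<close> may replace \<open>s 0\<close> and \<open>a 0\<close> because
    \<open>cross_sum\<close> reads only indices below \<open>k\<close>.\<close>
  from pseudometric_space.handicap_cost_bound[OF assms(1) this asm(1) s0 asm(4-6)]
  show "total_cost k d s n \<le> real k * total_cost k d a n +
      (real k * cross_sum k d a0 s0 + cross_sum k d s0 s0 / 2)"
    by (simp only: cross_sum_cong[OF asm(3) asm(2)] cross_sum_cong[OF asm(2) asm(2)])
qed

end
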